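(* Let $\mathbb{K}$ be a field and let $(G_m)_{m\ge1}$ be a family of finite groups with symmetric generating sets $S_m\subseteq G_m\setminus\{1\}$ ($S_m=S_m^{-1}$), $|S_m|=d$ for all $m$, such that $|G_m|\to\infty$ and the Cayley graphs $\mathrm{Cay}(G_m,S_m)$ form an expander family. Then the Cayley evolution algebras $(\mathcal{C}(G_m,S_m,\mathbb{K}))_{m\ge1}$ form an EEA family.
   Context: An evolution algebra over $\mathbb{K}$ (finite-dimensional) is an algebra $E$ with a linear basis $\mathcal{B}=\{e_i\}_{i\in\Lambda}$, $\Lambda$ finite (a natural basis), such that $e_ie_j=0$ for $i\neq j$ and $e_i^2=\sum_k a_{ik}e_k$ with $a_{ik}\in\mathbb{K}$. The graph $\Gamma(E,\mathcal{B})$ is the simple graph with vertex set $\Lambda$ and edges $\{i,j\}$, $i\ne j$, whenever $a_{ij}\neq0$ or $a_{ji}\ne0$. For a finite simple graph $\Gamma$ with vertex set $V$ and $W\subseteq V$, let $E(W)$ be the set of edges with exactly one endpoint in $W$; the Cheeger constant is $\mathfrak{h}(\Gamma)=\min\{|E(W)|/|W| : \emptyset\ne W\subsetneq V,\ |W|\le |V|/2\}$, with $\mathfrak{h}(\Gamma)=+\infty$ if $|V|\le1$. A family $(\Gamma_m)$ of finite connected graphs is an expander family if the numbers of vertices tend to infinity, the degrees are uniformly bounded over all $m$, and $\inf_m\mathfrak{h}(\Gamma_m)>0$. A family $(E_m,\mathcal{B}_m)_{m\ge1}$ of evolution algebras with $\dim E_m\to\infty$ is an EEA family if $\inf_m\mathfrak{h}(\Gamma(E_m,\mathcal{B}_m))>0$.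 The Cayley evolution algebra $\mathcal{C}(G,S,\mathbb{K})$ has natural basis $\{e_g:g\in G\}$ and $e_g^2=\sum_{s\in S}e_{gs}$. The Cayley graph $\mathrm{Cay}(G,S)$ has vertex set $G$ and edges $\{g,gs\}$ for $g\in G$, $s\in S$. *)

theory Defs
  imports
    "Jordan_Normal_Form.Missing_VectorSpace"
    "HOL-Algebra.Generated_Groups"
    "HOL-Library.Extended_Real"
begin

section \<open>Finite simple graphs, Cheeger constants, expanders\<close>

record 'v sgraph =
  verts :: "'v set"
  edges :: "'v set set"

definition finite_simple_graph :: "'v sgraph \<Rightarrow> bool" where
  "finite_simple_graph \<Gamma> \<longleftrightarrow>
     finite (verts \<Gamma>) \<and>
     edges \<Gamma> \<subseteq> {{u, v} | u v. u \<in> verts \<Gamma> \<and> v \<in> verts \<Gamma> \<and> u \<noteq> v}"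

definition connected_graph :: "'v sgraph \<Rightarrow> bool" where
  "connected_graph \<Gamma> \<longleftrightarrow>
     verts \<Gamma> \<noteq> {} \<and>
     (\<forall>u\<in>verts \<Gamma>. \<forall>v\<in>verts \<Gamma>. (u, v) \<in> {(x, y). {x, y} \<in> edges \<Gamma>}\<^sup>*)"

definition vertex_degree :: "'v sgraph \<Rightarrow> 'v \<Rightarrow> nat" where
  "vertex_degree \<Gamma> v = card {ed \<in> edges \<Gamma>. v \<in> ed}"

definition edge_boundary :: "'v sgraph \<Rightarrow> 'v set \<Rightarrow> 'v set set" where
  "edge_boundary \<Gamma> W = {ed \<in> edges \<Gamma>. card (ed \<inter> W) = 1}"

definition cheeger :: "'v sgraph \<Rightarrow> ereal" where
  "cheeger \<Gamma> =
     (if card (verts \<Gamma>) \<le> 1 then \<infinity>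
      else ereal (Min {real (card (edge_boundary \<Gamma> W)) / real (card W) | W.
             W \<noteq> {} \<and> W \<subset> verts \<Gamma> \<and> real (card W) \<le> real (card (verts \<Gamma>)) / 2}))"

text \<open>Families are indexed by the integers \<open>m \<ge> 1\<close>; the value at \<open>0\<close> is irrelevant.\<close>

definition expander_family :: "(nat \<Rightarrow> 'v sgraph) \<Rightarrow> bool" where
  "expander_family \<Gamma> \<longleftrightarrow>
     (\<forall>m\<ge>1. finite_simple_graph (\<Gamma> m) \<and> connected_graph (\<Gamma> m)) \<and>
     filterlim (\<lambda>m. card (verts (\<Gamma> m))) at_top sequentially \<and>
     (\<exists>D. \<forall>m\<ge>1. \<forall>v\<in>verts (\<Gamma> m). vertex_degree (\<Gamma> m) v \<le> D) \<and>
     (INF m\<in>{1..}. cheeger (\<Gamma> m)) > 0"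

definition cayley_graph :: "('g, 'c) monoid_scheme \<Rightarrow> 'g set \<Rightarrow> 'g sgraph" where
  "cayley_graph G S =
     \<lparr>verts = carrier G, edges = {{g, g \<otimes>\<^bsub>G\<^esub> s} | g s. g \<in> carrier G \<and> s \<in> S}\<rparr>"


section \<open>Evolution algebras\<close>

text \<open>
  An algebra is a vector space with a bilinear product, neither associative nor unital in general.
  The record type \<^typ>\<open>('k, 'v) module\<close> supplies all the operations; its field \<^const>\<open>one\<close> has no
  meaning here and is left unconstrained.
\<close>

locale bilinear_algebra = vectorspace K E
  for K :: "('k, 'c) ring_scheme" (structure)
    and E :: "('k, 'v, 'd) module_scheme" (structure) +
  assumes mult_closed: "x \<in> carrier E \<Longrightarrow> y \<in> carrier E \<Longrightarrow> x \<otimes>\<^bsub>E\<^esub> y \<in> carrier E"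
    and mult_add_left: "x \<in> carrier E \<Longrightarrow> y \<in> carrier E \<Longrightarrow> z \<in> carrier E \<Longrightarrow>
          (x \<oplus>\<^bsub>E\<^esub> y) \<otimes>\<^bsub>E\<^esub> z = x \<otimes>\<^bsub>E\<^esub> z \<oplus>\<^bsub>E\<^esub> y \<otimes>\<^bsub>E\<^esub> z"
    and mult_add_right: "x \<in> carrier E \<Longrightarrow> y \<in> carrier E \<Longrightarrow> z \<in> carrier E \<Longrightarrow>
          x \<otimes>\<^bsub>E\<^esub> (y \<oplus>\<^bsub>E\<^esub> z) = x \<otimes>\<^bsub>E\<^esub> y \<oplus>\<^bsub>E\<^esub> x \<otimes>\<^bsub>E\<^esub> z"
    and mult_smult_left: "c \<in> carrier K \<Longrightarrow> x \<in> carrier E \<Longrightarrow> y \<in> carrier E \<Longrightarrow>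
          (c \<odot>\<^bsub>E\<^esub> x) \<otimes>\<^bsub>E\<^esub> y = c \<odot>\<^bsub>E\<^esub> (x \<otimes>\<^bsub>E\<^esub> y)"
    and mult_smult_right: "c \<in> carrier K \<Longrightarrow> x \<in> carrier E \<Longrightarrow> y \<in> carrier E \<Longrightarrow>
          x \<otimes>\<^bsub>E\<^esub> (c \<odot>\<^bsub>E\<^esub> y) = c \<odot>\<^bsub>E\<^esub> (x \<otimes>\<^bsub>E\<^esub> y)"

text \<open>
  The pair \<open>(\<Lambda>, e)\<close> encodes the natural basis \<open>{e i | i \<in> \<Lambda>}\<close>. That \<open>e i \<otimes> e i\<close> is a linear
  combination of the basis is automatic.
\<close>

locale evolution_algebra = bilinear_algebra K E
  for K :: "('k, 'c) ring_scheme" (structure)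
    and E :: "('k, 'v, 'd) module_scheme" (structure)
    and \<Lambda> :: "'i set" and e :: "'i \<Rightarrow> 'v" +
  assumes finite_index: "finite \<Lambda>"
    and inj_basis: "inj_on e \<Lambda>"
    and is_basis: "vectorspace.basis K E (e ` \<Lambda>)"
    and mult_distinct: "i \<in> \<Lambda> \<Longrightarrow> j \<in> \<Lambda> \<Longrightarrow> i \<noteq> j \<Longrightarrow> e i \<otimes>\<^bsub>E\<^esub> e j = \<zero>\<^bsub>E\<^esub>"

text \<open>The coefficient \<open>a\<^sub>i\<^sub>k\<close> of \<open>e k\<close> in \<open>e i \<otimes> e i\<close>.\<close>

definition structure_constant ::
  "('k, 'c) ring_scheme \<Rightarrow> ('k, 'v, 'd) module_scheme \<Rightarrow> 'i set \<Rightarrow> ('i \<Rightarrow> 'v) \<Rightarrow> 'i \<Rightarrow> 'i \<Rightarrow> 'k" where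
  "structure_constant K E \<Lambda> e i =
     (THE a. a \<in> \<Lambda> \<rightarrow>\<^sub>E carrier K \<and> e i \<otimes>\<^bsub>E\<^esub> e i = (\<Oplus>\<^bsub>E\<^esub>k\<in>\<Lambda>. a k \<odot>\<^bsub>E\<^esub> e k))"

definition evolution_graph ::
  "('k, 'c) ring_scheme \<Rightarrow> ('k, 'v, 'd) module_scheme \<Rightarrow> 'i set \<Rightarrow> ('i \<Rightarrow> 'v) \<Rightarrow> 'i sgraph" where
  "evolution_graph K E \<Lambda> e =
     \<lparr>verts = \<Lambda>,
      edges = {{i, j} | i j. i \<in> \<Lambda> \<and> j \<in> \<Lambda> \<and> i \<noteq> j \<and>
                 (structure_constant K E \<Lambda> e i j \<noteq> \<zero>\<^bsub>K\<^esub> \<or>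
                  structure_constant K E \<Lambda> e j i \<noteq> \<zero>\<^bsub>K\<^esub>)}\<rparr>"

definition eea_family ::
  "('k, 'c) ring_scheme \<Rightarrow> (nat \<Rightarrow> ('k, 'v, 'd) module_scheme) \<Rightarrow>
   (nat \<Rightarrow> 'i set) \<Rightarrow> (nat \<Rightarrow> 'i \<Rightarrow> 'v) \<Rightarrow> bool" where
  "eea_family K E \<Lambda> e \<longleftrightarrow>
     (\<forall>m\<ge>1. evolution_algebra K (E m) (\<Lambda> m) (e m)) \<and>
     filterlim (\<lambda>m. vectorspace.dim K (E m)) at_top sequentially \<and>
     (INF m\<in>{1..}. cheeger (evolution_graph K (E m) (\<Lambda> m) (e m))) > 0"


section \<open>Cayley evolution algebras\<close>

definition cayley_basis ::
  "('k, 'c) ring_scheme \<Rightarrow> ('g, 'h) monoid_scheme \<Rightarrow> 'g \<Rightarrow> 'g \<Rightarrow> 'k" where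
  "cayley_basis K G g = (\<lambda>h\<in>carrier G. if h = g then \<one>\<^bsub>K\<^esub> else \<zero>\<^bsub>K\<^esub>)"

text \<open>
  The vector space is that of functions from \<open>G\<close> to \<open>K\<close>. The product is the bilinear extension of
  \<open>e\<^sub>g e\<^sub>h = 0\<close> for \<open>g \<noteq> h\<close> and \<open>e\<^sub>g e\<^sub>g = (\<Sum>s\<in>S. e\<^bsub>gs\<^esub>)\<close>, so that
  \<open>x y = (\<Sum>g. x\<^sub>g y\<^sub>g (\<Sum>s\<in>S. e\<^bsub>gs\<^esub>))\<close>. It replaces the zero product that \<^const>\<open>ring.func_space\<close>
  puts into its record.
\<close>

definition cayley_evolution_algebra ::
  "('g, 'h) monoid_scheme \<Rightarrow> 'g set \<Rightarrow> ('k, 'c) ring_scheme \<Rightarrow> ('k, 'g \<Rightarrow> 'k) module" where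
  "cayley_evolution_algebra G S K =
     (let V = ring.func_space K (carrier G) in
      V\<lparr>mult := \<lambda>x y. \<Oplus>\<^bsub>V\<^esub>g\<in>carrier G.
           (x g \<otimes>\<^bsub>K\<^esub> y g) \<odot>\<^bsub>V\<^esub> (\<Oplus>\<^bsub>V\<^esub>s\<in>S. cayley_basis K G (g \<otimes>\<^bsub>G\<^esub> s))\<rparr>)"

end

theory Submission
  imports Defs
begin

text \<open>
  Since a group element determines at most one \<open>s\<close> with \<open>k = g s\<close>, the structure constant \<open>a\<^sub>g\<^sub>k\<close> of
  the Cayley evolution algebra is \<open>1\<close> or \<open>0\<close>, whatever the field, and it is \<open>1\<close> exactly when
  \<open>k\<close> lies in \<open>gS\<close>. Hence the graph of the algebra is the Cayley graph itself, and the two Cheeger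
  constants agree.
\<close>

text \<open>The module axioms involve only the carrier, addition, zero and scalar action of
  \<open>M\<close>, so they survive a change of its product. This transfers the vector space
  structure of \<open>func_space\<close> to the Cayley evolution algebra.\<close>

lemma (in Module.module) module_mult_update: "Module.module R (M\<lparr>mult := f\<rparr>)"
proof -
  have "Module.module R M" ..
  then show ?thesis
    unfolding Module.module_def abelian_group_def abelian_monoid_def abelian_group_axioms_def
      Module.module_axioms_def
    by simp
qed

section \<open>Functions on the group as a vector space\<close>

locale cayley_algebra = G?: group G + K?: field K
  for G :: "('g, 'h) monoid_scheme" and K :: "('k, 'c) ring_scheme" +
  fixes S :: "'g set"
  assumes finite_G: "finite (carrier G)"
    and S_sub: "S \<subseteq> carrier G"
begin

abbreviation E where "E \<equiv> cayley_evolution_algebra G S K"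
abbreviation e where "e \<equiv> cayley_basis K G"

lemma finite_S: "finite S"
  using finite_G S_sub finite_subset by blast

lemma E_simps:
  "carrier E = carrier G \<rightarrow>\<^sub>E carrier K"
  "zero E = (\<lambda>g\<in>carrier G. \<zero>\<^bsub>K\<^esub>)"
  "x \<oplus>\<^bsub>E\<^esub> y = (\<lambda>g\<in>carrier G. x g \<oplus>\<^bsub>K\<^esub> y g)"
  "c \<odot>\<^bsub>E\<^esub> x = (\<lambda>g\<in>carrier G. c \<otimes>\<^bsub>K\<^esub> x g)"
  by (simp_all add: cayley_evolution_algebra_def func_space_def Let_def)

text \<open>\<open>finsum\<close> depends only on carrier, zero and addition, so the sums that the
  definition takes in the function space are the sums in \<open>E\<close>.\<close>

lemma mult_E:
  "x \<otimes>\<^bsub>E\<^esub> y = (\<Oplus>\<^bsub>E\<^esub>g\<in>carrier G. (x g \<otimes>\<^bsub>K\<^esub> y g) \<odot>\<^bsub>E\<^esub> (\<Oplus>\<^bsub>E\<^esub>s\<in>S. e (g \<otimes>\<^bsub>G\<^esub> s)))"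
  by (simp add: cayley_evolution_algebra_def Let_def finsum_def)

sublocale E: vectorspace K E
proof -
  have "Module.module K E"
    unfolding cayley_evolution_algebra_def Let_def
    by (rule module.module_mult_update[OF func_space_is_module])
  then show "vectorspace K E"
    using K.field_axioms by (rule vectorspace.intro)
qed

lemma E_apply_closed: "x \<in> carrier E \<Longrightarrow> g \<in> carrier G \<Longrightarrow> x g \<in> carrier K"
  by (auto simp: E_simps)

text \<open>Addition in \<open>E\<close> is pointwise, so evaluation at a group element is additive.
  This turns identities in \<open>E\<close> into identities in \<open>K\<close>.\<close>

lemma finsum_E_apply:
  assumes "f \<in> B \<rightarrow> carrier E" "h \<in> carrier G"
  shows "(\<Oplus>\<^bsub>E\<^esub>b\<in>B. f b) h = (\<Oplus>\<^bsub>K\<^esub>b\<in>B. f b h)"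
  using assms(1)
\<comment> \<open>If \<open>B\<close> is infinite, both sums have the default value zero.\<close>
proof (induction B rule: infinite_finite_induct)
  case (insert b B)
  then have "f \<in> B \<rightarrow> carrier E" "f b \<in> carrier E"
    and "(\<lambda>b. f b h) \<in> B \<rightarrow> carrier K" "f b h \<in> carrier K"
    using E_apply_closed[OF _ assms(2)] by auto
  with insert assms(2) show ?case
    by (simp add: E.M.finsum_insert K.finsum_insert E_simps(3))
qed (use assms(2) in \<open>auto simp: E_simps(2)\<close>)

section \<open>The indicator functions as a basis\<close>

lemma e_closed: "e g \<in> carrier E"
  by (auto simp: cayley_basis_def E_simps)

lemma e_apply: "h \<in> carrier G \<Longrightarrow> e g h = (if h = g then \<one>\<^bsub>K\<^esub> else \<zero>\<^bsub>K\<^esub>)"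
  by (simp add: cayley_basis_def)

lemma inj_on_e: "inj_on e (carrier G)"
proof (rule inj_onI)
  fix g h assume "g \<in> carrier G" "e g = e h"
  then have "e h g = \<one>\<^bsub>K\<^esub>"
    using e_apply[of g g] by simp
  with \<open>g \<in> carrier G\<close> show "g = h"
    by (auto simp: e_apply split: if_splits)
qed

text \<open>Evaluation at \<open>h\<close> annihilates every \<open>e g\<close> except
  \<open>e h\<close>, so it reads off the coefficient there. Linear independence and the expansion
  of a vector both rest on this.\<close>

lemma combination_apply:
  assumes "B \<subseteq> carrier G" "a \<in> B \<rightarrow> carrier K" "h \<in> carrier G"
  shows "(\<Oplus>\<^bsub>E\<^esub>g\<in>B. a g \<odot>\<^bsub>E\<^esub> e g) h = (if h \<in> B then a h else \<zero>\<^bsub>K\<^esub>)"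
proof -
  have fin: "finite B"
    using assms(1) finite_G finite_subset by blast
  have "(\<Oplus>\<^bsub>E\<^esub>g\<in>B. a g \<odot>\<^bsub>E\<^esub> e g) h = (\<Oplus>\<^bsub>K\<^esub>g\<in>B. (a g \<odot>\<^bsub>E\<^esub> e g) h)"
    using assms e_closed by (intro finsum_E_apply) (auto intro!: E.smult_closed)
  also have "\<dots> = (\<Oplus>\<^bsub>K\<^esub>g\<in>B. if h = g then a g else \<zero>\<^bsub>K\<^esub>)"
    using assms by (intro K.finsum_cong') (auto simp: E_simps(4) e_apply dest: Pi_mem)
  also have "\<dots> = (if h \<in> B then a h else \<zero>\<^bsub>K\<^esub>)"
    using K.finsum_singleton[of h B a] fin assms(2) by (auto intro!: K.finsum_all0)
  finally show ?thesis .
qed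

lemma expansion:
  assumes "x \<in> carrier E"
  shows "(\<Oplus>\<^bsub>E\<^esub>g\<in>carrier G. x g \<odot>\<^bsub>E\<^esub> e g) = x"
proof (rule PiE_ext)
  show "(\<Oplus>\<^bsub>E\<^esub>g\<in>carrier G. x g \<odot>\<^bsub>E\<^esub> e g) \<in> carrier G \<rightarrow>\<^sub>E carrier K"
    unfolding E_simps(1)[symmetric] using assms e_closed E_apply_closed
    by (intro E.M.finsum_closed) (auto intro!: E.smult_closed)
  show "x \<in> carrier G \<rightarrow>\<^sub>E carrier K"
    using assms by (simp add: E_simps)
  show "(\<Oplus>\<^bsub>E\<^esub>g\<in>carrier G. x g \<odot>\<^bsub>E\<^esub> e g) h = x h" if "h \<in> carrier G" for h
    using combination_apply[of "carrier G" x h] that assms E_apply_closed by auto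
qed

text \<open>\<open>lincomb\<close> takes coefficients indexed by vectors; injectivity of
  \<open>e\<close> allows reindexing by group elements.\<close>

lemma lincomb_e:
  assumes "B \<subseteq> carrier G" "a \<in> e ` B \<rightarrow> carrier K"
  shows "E.lincomb a (e ` B) = (\<Oplus>\<^bsub>E\<^esub>g\<in>B. a (e g) \<odot>\<^bsub>E\<^esub> e g)"
  unfolding E.lincomb_def
  using assms e_closed inj_on_subset[OF inj_on_e]
  by (intro E.M.finsum_reindex) (auto intro!: E.smult_closed)

lemma basis_e: "E.basis (e ` carrier G)"
  unfolding E.basis_def
proof (intro conjI)
  show closed: "e ` carrier G \<subseteq> carrier E"
    using e_closed by auto
  show "E.lin_indpt (e ` carrier G)"
  proof
    assume "E.lin_dep (e ` carrier G)"
    then obtain A a v where A: "A \<subseteq> e ` carrier G" "a \<in> A \<rightarrow> carrier K"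
      "E.lincomb a A = \<zero>\<^bsub>E\<^esub>" "v \<in> A" "a v \<noteq> \<zero>\<^bsub>K\<^esub>"
      unfolding E.lin_dep_def by auto
    from A(1) obtain B where B: "B \<subseteq> carrier G" "A = e ` B"
      by (auto simp: subset_image_iff)
    with A(4) obtain g where g: "g \<in> B" "v = e g"
      by auto
    \<comment> \<open>Evaluating the vanishing combination at \<open>g\<close> isolates the
      coefficient of \<open>e g\<close>.\<close>
    have "a v = E.lincomb a A g"
      using lincomb_e[of B a] combination_apply[of B "\<lambda>g. a (e g)" g] B A(2) g
      by (simp add: Pi_iff subset_iff)
    also have "\<dots> = \<zero>\<^bsub>K\<^esub>"
      using A(3) g B by (auto simp: E_simps(2))
    finally show False
      using A(5) by simp
  qed
  show "E.gen_set (e ` carrier G)"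
  proof
    show "E.span (e ` carrier G) \<subseteq> carrier E"
      using closed by (rule E.span_is_subset2)
    show "carrier E \<subseteq> E.span (e ` carrier G)"
    proof
      fix x assume x: "x \<in> carrier E"
      \<comment> \<open>Coefficients must be a function of the basis vector, so its index is
        recovered by inverting \<open>e\<close>; the coefficient of \<open>e g\<close> is then
        \<open>x g\<close>.\<close>
      let ?a = "\<lambda>v. x (the_inv_into (carrier G) e v)"
      have inv: "the_inv_into (carrier G) e (e g) = g" if "g \<in> carrier G" for g
        using inj_on_e that by (rule the_inv_into_f_f)
      have a: "?a \<in> e ` carrier G \<rightarrow> carrier K"
        using x by (auto simp: inv E_apply_closed)
      have "E.lincomb ?a (e ` carrier G) = (\<Oplus>\<^bsub>E\<^esub>g\<in>carrier G. x g \<odot>\<^bsub>E\<^esub> e g)"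
        unfolding lincomb_e[OF order_refl a] using x e_closed
        by (intro E.M.finsum_cong') (auto simp: inv E_apply_closed intro!: E.smult_closed)
      then have "E.lincomb ?a (e ` carrier G) = x"
        using expansion[OF x] by simp
      with a finite_G show "x \<in> E.span (e ` carrier G)"
        unfolding E.span_def
        by (intro CollectI exI[of _ ?a] exI[of _ "e ` carrier G"]) simp
    qed
  qed
qed

lemma dim_E: "E.dim = card (carrier G)"
  using E.dim_basis[OF _ basis_e] finite_G card_image[OF inj_on_e] by simp

section \<open>Bilinearity of the product and products of basis vectors\<close>

lemma sum_e_closed: "(\<Oplus>\<^bsub>E\<^esub>s\<in>S. e (g \<otimes>\<^bsub>G\<^esub> s)) \<in> carrier E"
  using e_closed by (intro E.M.finsum_closed) auto

lemma sum_e_apply: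
  assumes "g \<in> carrier G" "k \<in> carrier G"
  shows "(\<Oplus>\<^bsub>E\<^esub>s\<in>S. e (g \<otimes>\<^bsub>G\<^esub> s)) k = (if \<exists>s\<in>S. k = g \<otimes>\<^bsub>G\<^esub> s then \<one>\<^bsub>K\<^esub> else \<zero>\<^bsub>K\<^esub>)"
proof -
  \<comment> \<open>By cancellation, \<open>?t\<close> is the only candidate for an \<open>s\<close>
    that carries \<open>g\<close> to \<open>k\<close>, so the sum over \<open>S\<close> has at most
    one nonzero term.\<close>
  let ?t = "inv\<^bsub>G\<^esub> g \<otimes>\<^bsub>G\<^esub> k"
  have eq: "k = g \<otimes>\<^bsub>G\<^esub> s \<longleftrightarrow> ?t = s" if "s \<in> S" for s
    using that S_sub assms G.inv_solve_left[of s g k] by auto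
  have "(\<Oplus>\<^bsub>E\<^esub>s\<in>S. e (g \<otimes>\<^bsub>G\<^esub> s)) k = (\<Oplus>\<^bsub>K\<^esub>s\<in>S. e (g \<otimes>\<^bsub>G\<^esub> s) k)"
    using assms e_closed by (intro finsum_E_apply) auto
  also have "\<dots> = (\<Oplus>\<^bsub>K\<^esub>s\<in>S. if ?t = s then \<one>\<^bsub>K\<^esub> else \<zero>\<^bsub>K\<^esub>)"
    using assms eq by (intro K.finsum_cong') (auto simp: e_apply)
  also have "\<dots> = (if ?t \<in> S then \<one>\<^bsub>K\<^esub> else \<zero>\<^bsub>K\<^esub>)"
    using K.finsum_singleton[of ?t S "\<lambda>_. \<one>\<^bsub>K\<^esub>"] finite_S by (auto intro!: K.finsum_all0)
  also have "?t \<in> S \<longleftrightarrow> (\<exists>s\<in>S. k = g \<otimes>\<^bsub>G\<^esub> s)"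
    using eq by auto
  finally show ?thesis .
qed

lemma mult_summand_closed:
  assumes "x \<in> carrier E" "y \<in> carrier E"
  shows "(\<lambda>g. (x g \<otimes>\<^bsub>K\<^esub> y g) \<odot>\<^bsub>E\<^esub> (\<Oplus>\<^bsub>E\<^esub>s\<in>S. e (g \<otimes>\<^bsub>G\<^esub> s))) \<in> carrier G \<rightarrow> carrier E"
  using assms sum_e_closed E_apply_closed by (auto intro!: E.smult_closed)

lemma mult_E_closed: "x \<in> carrier E \<Longrightarrow> y \<in> carrier E \<Longrightarrow> x \<otimes>\<^bsub>E\<^esub> y \<in> carrier E"
  unfolding mult_E by (intro E.M.finsum_closed mult_summand_closed)

text \<open>The product formula is symmetric in \<open>x\<close> and \<open>y\<close> because
  \<open>K\<close> is commutative. The laws for the right argument thus follow from those for the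
  left.\<close>

lemma mult_E_commute:
  assumes "x \<in> carrier E" "y \<in> carrier E"
  shows "x \<otimes>\<^bsub>E\<^esub> y = y \<otimes>\<^bsub>E\<^esub> x"
  unfolding mult_E using assms mult_summand_closed
  by (intro E.M.finsum_cong') (auto simp: K.m_comm E_apply_closed)

text \<open>Merging the two sums on the right leaves a termwise comparison, settled by
  distributivity in \<open>K\<close> and of the scalar action.\<close>

lemma mult_E_add_left:
  assumes "x \<in> carrier E" "y \<in> carrier E" "z \<in> carrier E"
  shows "(x \<oplus>\<^bsub>E\<^esub> y) \<otimes>\<^bsub>E\<^esub> z = x \<otimes>\<^bsub>E\<^esub> z \<oplus>\<^bsub>E\<^esub> y \<otimes>\<^bsub>E\<^esub> z"
  unfolding mult_E
    E.M.finsum_addf[OF mult_summand_closed[OF assms(1,3)] mult_summand_closed[OF assms(2,3)], symmetric]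
  using assms sum_e_closed
  by (intro E.M.finsum_cong')
    (auto simp: E_simps(3)[of x y] E_apply_closed K.l_distr E.smult_l_distr
      intro!: E.smult_closed E.M.a_closed)

lemma mult_E_smult_left:
  assumes "c \<in> carrier K" "x \<in> carrier E" "y \<in> carrier E"
  shows "(c \<odot>\<^bsub>E\<^esub> x) \<otimes>\<^bsub>E\<^esub> y = c \<odot>\<^bsub>E\<^esub> (x \<otimes>\<^bsub>E\<^esub> y)"
  unfolding mult_E E.finsum_smult[OF assms(1) mult_summand_closed[OF assms(2,3)]]
  using assms sum_e_closed
  by (intro E.M.finsum_cong')
    (auto simp: E_simps(4)[of c x] E_apply_closed K.m_assoc E.smult_assoc1
      intro!: E.smult_closed)

text \<open>The supports are disjoint, so every summand carries a zero coefficient.\<close>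

lemma e_mult_distinct:
  assumes "i \<noteq> j"
  shows "e i \<otimes>\<^bsub>E\<^esub> e j = \<zero>\<^bsub>E\<^esub>"
  unfolding mult_E using assms sum_e_closed
  by (intro E.M.finsum_all0) (auto simp: e_apply)

text \<open>Only the summand at \<open>i\<close> survives; this recovers the defining rule for
  squares from the coordinate formula for the product.\<close>

lemma e_square:
  assumes "i \<in> carrier G"
  shows "e i \<otimes>\<^bsub>E\<^esub> e i = (\<Oplus>\<^bsub>E\<^esub>s\<in>S. e (i \<otimes>\<^bsub>G\<^esub> s))"
proof -
  let ?w = "\<lambda>g. \<Oplus>\<^bsub>E\<^esub>s\<in>S. e (g \<otimes>\<^bsub>G\<^esub> s)"
  have "e i \<otimes>\<^bsub>E\<^esub> e i = (\<Oplus>\<^bsub>E\<^esub>g\<in>carrier G. if i = g then ?w g else \<zero>\<^bsub>E\<^esub>)"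
    unfolding mult_E using sum_e_closed
    by (intro E.M.finsum_cong') (auto simp: e_apply)
  also have "\<dots> = ?w i"
    using assms finite_G sum_e_closed by (intro E.M.finsum_singleton) auto
  finally show ?thesis .
qed

lemma evolution_algebra_E: "evolution_algebra K E (carrier G) e"
proof unfold_locales
  fix x y z assume *: "x \<in> carrier E" "y \<in> carrier E" "z \<in> carrier E"
  show "x \<otimes>\<^bsub>E\<^esub> (y \<oplus>\<^bsub>E\<^esub> z) = x \<otimes>\<^bsub>E\<^esub> y \<oplus>\<^bsub>E\<^esub> x \<otimes>\<^bsub>E\<^esub> z"
    using mult_E_add_left[OF *(2,3,1)] * by (simp add: mult_E_commute[of x])
next
  fix c x y assume *: "c \<in> carrier K" "x \<in> carrier E" "y \<in> carrier E"
  show "x \<otimes>\<^bsub>E\<^esub> (c \<odot>\<^bsub>E\<^esub> y) = c \<odot>\<^bsub>E\<^esub> (x \<otimes>\<^bsub>E\<^esub> y)"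
    using mult_E_smult_left[OF *(1,3,2)] * by (simp add: mult_E_commute[of x])
qed (use mult_E_closed mult_E_add_left mult_E_smult_left finite_G inj_on_e basis_e e_mult_distinct
  in auto)

section \<open>Structure constants and the graph of the algebra\<close>

lemma structure_constant_E:
  assumes "i \<in> carrier G" "k \<in> carrier G"
  shows "structure_constant K E (carrier G) e i k =
    (if \<exists>s\<in>S. k = i \<otimes>\<^bsub>G\<^esub> s then \<one>\<^bsub>K\<^esub> else \<zero>\<^bsub>K\<^esub>)"
proof -
  let ?x = "e i \<otimes>\<^bsub>E\<^esub> e i"
  have x: "?x \<in> carrier E"
    by (intro mult_E_closed e_closed)
  \<comment> \<open>A vector of \<open>E\<close> is its own coordinate function, so the square
    \<open>?x\<close> serves as its family of coefficients.\<close>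
  have "structure_constant K E (carrier G) e i = ?x"
    unfolding structure_constant_def
  proof (rule the_equality)
    show "?x \<in> carrier G \<rightarrow>\<^sub>E carrier K \<and> ?x = (\<Oplus>\<^bsub>E\<^esub>k\<in>carrier G. ?x k \<odot>\<^bsub>E\<^esub> e k)"
      using x expansion[OF x] by (simp add: E_simps(1))
  next
    \<comment> \<open>Any competing \<open>a\<close> lies in the same extensional function space and
      is thus an element of \<open>E\<close>; by \<open>expansion\<close> its combination of the
      basis is \<open>a\<close> itself.\<close>
    fix a assume "a \<in> carrier G \<rightarrow>\<^sub>E carrier K \<and> ?x = (\<Oplus>\<^bsub>E\<^esub>k\<in>carrier G. a k \<odot>\<^bsub>E\<^esub> e k)"
    then show "a = ?x"
      using expansion[of a] by (simp add: E_simps(1))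
  qed
  then show ?thesis
    using e_square[OF assms(1)] sum_e_apply[OF assms] by simp
qed

lemma evolution_graph_E:
  assumes "\<one>\<^bsub>G\<^esub> \<notin> S"
  shows "evolution_graph K E (carrier G) e = cayley_graph G S"
proof -
  have "(i \<in> carrier G \<and> j \<in> carrier G \<and> i \<noteq> j \<and>
      (structure_constant K E (carrier G) e i j \<noteq> \<zero>\<^bsub>K\<^esub> \<or>
       structure_constant K E (carrier G) e j i \<noteq> \<zero>\<^bsub>K\<^esub>)) \<longleftrightarrow>
    (i \<in> carrier G \<and> (\<exists>s\<in>S. j = i \<otimes>\<^bsub>G\<^esub> s)) \<or> (j \<in> carrier G \<and> (\<exists>s\<in>S. i = j \<otimes>\<^bsub>G\<^esub> s))"
    for i j
  proof -
    \<comment> \<open>Since the identity is not in \<open>S\<close>, right multiplication by a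
      generator moves every element: Cayley edges are never loops, which matches the condition
      \<open>i \<noteq> j\<close>.\<close>
    have "g \<otimes>\<^bsub>G\<^esub> s \<in> carrier G" "g \<otimes>\<^bsub>G\<^esub> s \<noteq> g" if "g \<in> carrier G" "s \<in> S" for g s
      using that S_sub assms by auto
    then show ?thesis
      by (auto simp: structure_constant_E split: if_splits) metis+
  qed
  then show ?thesis
    unfolding evolution_graph_def cayley_graph_def by (auto simp: insert_commute)
qed

end

section \<open>Passage to families\<close>

theorem corollary9p4:
  fixes K :: "('k, 'c) ring_scheme"
    and G :: "nat \<Rightarrow> ('g, 'h) monoid_scheme"
    and S :: "nat \<Rightarrow> 'g set"
    and d :: nat
  assumes "field K"
    and "\<And>m. m \<ge> 1 \<Longrightarrow> group (G m)"
    and "\<And>m. m \<ge> 1 \<Longrightarrow> finite (carrier (G m))"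
    and "\<And>m. m \<ge> 1 \<Longrightarrow> S m \<subseteq> carrier (G m) - {\<one>\<^bsub>G m\<^esub>}"
    and "\<And>m. m \<ge> 1 \<Longrightarrow> S m = (\<lambda>s. inv\<^bsub>G m\<^esub> s) ` S m"
    and "\<And>m. m \<ge> 1 \<Longrightarrow> generate (G m) (S m) = carrier (G m)"
    and "\<And>m. m \<ge> 1 \<Longrightarrow> card (S m) = d"
    and "filterlim (\<lambda>m. card (carrier (G m))) at_top sequentially"
    and "expander_family (\<lambda>m. cayley_graph (G m) (S m))"
  shows "eea_family K
           (\<lambda>m. cayley_evolution_algebra (G m) (S m) K)
           (\<lambda>m. carrier (G m))
           (\<lambda>m. cayley_basis K (G m))"
proof -
  have cayley: "cayley_algebra (G m) K (S m)" if "m \<ge> 1" for m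
    using assms(1) assms(2-4)[OF that] by (auto intro!: cayley_algebra.intro simp: cayley_algebra_axioms_def)
  \<comment> \<open>At index 0 nothing is assumed about the group, so orders and dimensions are
    compared only eventually, which suffices for the limit.\<close>
  have "\<forall>\<^sub>F m in sequentially.
      card (carrier (G m)) = vectorspace.dim K (cayley_evolution_algebra (G m) (S m) K)"
    using eventually_ge_at_top[of 1] by eventually_elim (simp add: cayley cayley_algebra.dim_E)
  from filterlim_cong[OF refl refl this] assms(8)
  have "filterlim (\<lambda>m. vectorspace.dim K (cayley_evolution_algebra (G m) (S m) K)) at_top sequentially"
    by simp
  moreover have "evolution_graph K (cayley_evolution_algebra (G m) (S m) K) (carrier (G m))
      (cayley_basis K (G m)) = cayley_graph (G m) (S m)" if "m \<ge> 1" for m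
    using cayley_algebra.evolution_graph_E[OF cayley[OF that]] assms(4)[OF that] by blast
  \<comment> \<open>The infimum ranges over the indices where the graphs coincide, so its positivity
    carries over from the expander hypothesis.\<close>
  then have "(INF m\<in>{1..}. cheeger (evolution_graph K (cayley_evolution_algebra (G m) (S m) K)
      (carrier (G m)) (cayley_basis K (G m)))) = (INF m\<in>{1..}. cheeger (cayley_graph (G m) (S m)))"
    by (intro INF_cong) auto
  ultimately show ?thesis
    using assms(9) cayley_algebra.evolution_algebra_E[OF cayley]
    unfolding eea_family_def expander_family_def by simp
qed

end
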